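(* Let $h\ge 2$ be a fixed integer and let $G\sim G_n^h$ or $G\sim\tilde G_n^h$ (two preferential attachment models). Then with high probability, i.e. with probability tending to $1$ as $n\to\infty$, $$q^*(G)\le 0.92383.$$
   Context: Graphs are finite multigraphs (loops and multiple edges allowed); a loop counts $2$ towards the degree of its vertex, except for the one special loop indicated below. For a graph $G=(V,E)$ and $S\subseteq V$: $e(G)=|E|$; $e(S)$ is the number of edges (including loops, with multiplicity) with all endpoints in $S$; $\mathrm{vol}(S)=\sum_{v\in S}\deg(v)$ and $\mathrm{vol}(G)=\mathrm{vol}(V)$. For a graph with at least one edge and a partition $\mathcal A$ of $V$, the modularity score is $$q_{\mathcal A}(G)=\sum_{S\in\mathcal A}\left(\frac{e(S)}{e(G)}-\left(\frac{\mathrm{vol}(S)}{\mathrm{vol}(G)}\right)^2\right),$$ and the modularity of $G$ is $q^*(G)=\max_{\mathcal A}q_{\mathcal A}(G)$, the maximum being over all partitions $\mathcal A$ of $V$. Model $G_n^h$ ($h,n\in\mathbb N$). $T_1$ is a single mini-vertex $1$ with a loop $e_1$ (so it has degree $2$). For $t\ge1$, $T_{t+1}$ is obtained from $T_t$ by adding a mini-vertex $t+1$ and an edge $e_{t+1}$ joining $t+1$ to a random mini-vertex $i$, where, conditionally on $T_t$, $\mathbb P(i=s)=\deg_{T_t}(s)/(2t+1)$ for $1\le s\le t$ and $\mathbb P(i=t+1)=1/(2t+1)$ (in which case $e_{t+1}$ is a loop). $G_n^h$ is the random multigraph on $\{1,\dots,n\}$ obtained from $T_{hn}$ by merging, for each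 $i\in\{1,\dots,n\}$, the mini-vertices $h(i-1)+1,\dots,h(i-1)+h$ into a single vertex $i$, keeping loops and multiple edges. Model $\tilde G_n^h$. $\tilde T_1$ is a single mini-vertex $1$ with a loop $e_1$, where this loop contributes only $1$ to the degree of mini-vertex $1$. For $t\ge 1$, $\tilde T_{t+1}$ is obtained from $\tilde T_t$ by adding a mini-vertex $t+1$ and an edge $e_{t+1}$ joining it to a random mini-vertex $i\in\{1,\dots,t\}$ with, conditionally on $\tilde T_t$, $\mathbb P(i=s)=\deg_{\tilde T_t}(s)/(2t-1)$ for $1\le s\le t$. $\tilde G_n^h$ is obtained from $\tilde T_{hn}$ by the same merging of consecutive blocks of $h$ mini-vertices. In $\tilde G_n^h$ the loop $e_1$ contributes $1$ to the degree of vertex $1$; every other loop contributes $2$. *)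

theory Defs
  imports "HOL-Probability.Probability" "HOL-Library.Disjoint_Sets" "HOL-Library.Multiset"
begin

text \<open>
  Finite multigraphs. An edge is the multiset of its endpoints: \<open>{#u, v#}\<close> joins \<open>u\<close> and \<open>v\<close>,
  an ordinary loop at \<open>v\<close> is \<open>{#v, v#}\<close> (contributing 2 to the degree of \<open>v\<close>), and the special
  loop that contributes only 1 to the degree is \<open>{#v#}\<close>.
\<close>

datatype 'v multigraph = Multigraph (verts: "'v set") (edges: "'v multiset multiset")

definition num_edges :: "'v multigraph \<Rightarrow> nat" where
  "num_edges G = size (edges G)"

definition num_edges_in :: "'v multigraph \<Rightarrow> 'v set \<Rightarrow> nat" where
  "num_edges_in G S = size (filter_mset (\<lambda>e. set_mset e \<subseteq> S) (edges G))"

definition deg :: "'v multigraph \<Rightarrow> 'v \<Rightarrow> nat" where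
  "deg G v = (\<Sum>e\<in>#edges G. count e v)"

definition vol :: "'v multigraph \<Rightarrow> 'v set \<Rightarrow> nat" where
  "vol G S = (\<Sum>v\<in>S. deg G v)"

definition modularity_score :: "'v multigraph \<Rightarrow> 'v set set \<Rightarrow> real" where
  "modularity_score G P =
     (\<Sum>S\<in>P. real (num_edges_in G S) / real (num_edges G)
              - (real (vol G S) / real (vol G (verts G)))\<^sup>2)"

text \<open>Meaningful only if \<open>verts G\<close> is finite and \<open>G\<close> has at least one edge.\<close>

definition modularity :: "'v multigraph \<Rightarrow> real" where
  "modularity G = Max {modularity_score G P | P. partition_on (verts G) P}"


definition add_mini_vertex :: "nat \<Rightarrow> nat multigraph \<Rightarrow> nat \<Rightarrow> nat multigraph" where
  "add_mini_vertex v T i = Multigraph (insert v (verts T)) (add_mset {#v, i#} (edges T))"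

text \<open>
  \<open>attach t T\<close> and \<open>attach' t T\<close> are the laws of the endpoint \<open>i\<close> of the edge of mini-vertex
  \<open>t + 1\<close> in the two models, given that the current graph on \<open>{1..t}\<close> is \<open>T\<close>. The weights do form
  a probability distribution for every \<open>T\<close> that can occur; see \<open>pmf_attach\<close> and \<open>pmf_attach'\<close>
  below.
\<close>

definition attach :: "nat \<Rightarrow> nat multigraph \<Rightarrow> nat pmf" where
  "attach t T = embed_pmf (\<lambda>s. if s \<in> {1..t} then real (deg T s) / (2 * real t + 1)
                               else if s = t + 1 then 1 / (2 * real t + 1) else 0)"

definition attach' :: "nat \<Rightarrow> nat multigraph \<Rightarrow> nat pmf" where
  "attach' t T = embed_pmf (\<lambda>s. if s \<in> {1..t} then real (deg T s) / (2 * real t - 1) else 0)"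

text \<open>The processes start at time 1; the value at time 0 is only there for totality.\<close>

fun pa_tree :: "nat \<Rightarrow> nat multigraph pmf" where
  "pa_tree 0 = return_pmf (Multigraph {} {#})"
| "pa_tree (Suc 0) = return_pmf (Multigraph {1} {#{#1, 1#}#})"
| "pa_tree (Suc (Suc t)) =
     do { T \<leftarrow> pa_tree (Suc t);
          i \<leftarrow> attach (Suc t) T;
          return_pmf (add_mini_vertex (Suc (Suc t)) T i) }"

fun pa_tree' :: "nat \<Rightarrow> nat multigraph pmf" where
  "pa_tree' 0 = return_pmf (Multigraph {} {#})"
| "pa_tree' (Suc 0) = return_pmf (Multigraph {1} {#{#1#}#})"
| "pa_tree' (Suc (Suc t)) =
     do { T \<leftarrow> pa_tree' (Suc t);
          i \<leftarrow> attach' (Suc t) T;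
          return_pmf (add_mini_vertex (Suc (Suc t)) T i) }"

definition block :: "nat \<Rightarrow> nat \<Rightarrow> nat" where
  "block h j = (j - 1) div h + 1"

lemma block_eq_iff:
  assumes "h \<ge> 1" "i \<ge> 1" "j \<ge> 1"
  shows "block h j = i \<longleftrightarrow> j \<in> {h * (i - 1) + 1..h * (i - 1) + h}"
proof -
  obtain i' j' where ij: "i = Suc i'" "j = Suc j'"
    using assms by (metis Suc_le_D One_nat_def)
  have "j' div h = i' \<longleftrightarrow> h * i' \<le> j' \<and> j' < h * i' + h"
    using assms(1) by (auto intro: div_nat_eqI simp: dividend_less_times_div add.commute)
  then show ?thesis by (auto simp: block_def ij)
qed

definition merge_blocks :: "nat \<Rightarrow> nat \<Rightarrow> nat multigraph \<Rightarrow> nat multigraph" where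
  "merge_blocks h n T = Multigraph {1..n} (image_mset (image_mset (block h)) (edges T))"

definition pa_graph :: "nat \<Rightarrow> nat \<Rightarrow> nat multigraph pmf" where
  "pa_graph h n = map_pmf (merge_blocks h n) (pa_tree (h * n))"

definition pa_graph' :: "nat \<Rightarrow> nat \<Rightarrow> nat multigraph pmf" where
  "pa_graph' h n = map_pmf (merge_blocks h n) (pa_tree' (h * n))"


lemma deg_add_mini_vertex:
  "deg (add_mini_vertex v T i) s = deg T s + (if s = v then 1 else 0) + (if s = i then 1 else 0)"
  by (auto simp: deg_def add_mini_vertex_def)

lemma pmf_attach_aux:
  assumes "(\<Sum>s\<in>{1..t}. deg T s) = 2 * t"
  shows "pmf (attach t T) s = (if s \<in> {1..t} then real (deg T s) / (2 * real t + 1)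
                               else if s = t + 1 then 1 / (2 * real t + 1) else 0)"
  unfolding attach_def
proof (rule pmf_embed_pmf)
  let ?f = "\<lambda>s. if s \<in> {1..t} then real (deg T s) / (2 * real t + 1)
                else if s = t + 1 then 1 / (2 * real t + 1) else 0"
  show "0 \<le> ?f x" for x by auto
  have "(\<integral>\<^sup>+x. ennreal (?f x) \<partial>count_space UNIV) = (\<Sum>x\<in>{1..Suc t}. ennreal (?f x))"
    by (rule nn_integral_count_space') auto
  also have "\<dots> = ennreal (\<Sum>x\<in>{1..Suc t}. ?f x)"
    by (rule sum_ennreal) auto
  also have "(\<Sum>x\<in>{1..Suc t}. ?f x) = (\<Sum>x\<in>{1..t}. real (deg T x) / (2 * real t + 1)) + 1 / (2 * real t + 1)"
    by simp
  also have "(\<Sum>x\<in>{1..t}. real (deg T x) / (2 * real t + 1)) = real (2 * t) / (2 * real t + 1)"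
    by (simp only: assms[symmetric] of_nat_sum sum_divide_distrib)
  also have "real (2 * t) / (2 * real t + 1) + 1 / (2 * real t + 1) = 1"
    by (simp add: field_simps)
  finally show "(\<integral>\<^sup>+x. ennreal (?f x) \<partial>count_space UNIV) = 1" by simp
qed

lemma pmf_attach'_aux:
  assumes "(\<Sum>s\<in>{1..t}. deg T s) = 2 * t - 1" "t \<ge> 1"
  shows "pmf (attach' t T) s = (if s \<in> {1..t} then real (deg T s) / (2 * real t - 1) else 0)"
  unfolding attach'_def
proof (rule pmf_embed_pmf)
  let ?f = "\<lambda>s. if s \<in> {1..t} then real (deg T s) / (2 * real t - 1) else 0"
  show nn: "0 \<le> ?f x" for x using assms(2) by auto
  have "(\<integral>\<^sup>+x. ennreal (?f x) \<partial>count_space UNIV) = (\<Sum>x\<in>{1..t}. ennreal (?f x))"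
    by (rule nn_integral_count_space') auto
  also have "\<dots> = ennreal (\<Sum>x\<in>{1..t}. ?f x)"
    by (rule sum_ennreal) (use nn in auto)
  also have "(\<Sum>x\<in>{1..t}. ?f x) = (\<Sum>x\<in>{1..t}. real (deg T x) / (2 * real t - 1))"
    by simp
  also have "\<dots> = real (2 * t - 1) / (2 * real t - 1)"
    by (simp only: assms(1)[symmetric] of_nat_sum sum_divide_distrib)
  also have "\<dots> = 1"
    using assms(2) by (simp add: of_nat_diff)
  finally show "(\<integral>\<^sup>+x. ennreal (?f x) \<partial>count_space UNIV) = 1" by simp
qed

lemma pa_tree_invar:
  "T \<in> set_pmf (pa_tree t) \<Longrightarrow>
     verts T = {1..t} \<and> size (edges T) = t \<and> (\<forall>s. s \<notin> {1..t} \<longrightarrow> deg T s = 0)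
     \<and> (\<Sum>s\<in>{1..t}. deg T s) = 2 * t"
proof (induction t arbitrary: T rule: pa_tree.induct)
  case 1
  then show ?case by (simp add: deg_def)
next
  case 2
  then show ?case by (simp add: deg_def)
next
  case (3 t)
  from 3(2) obtain U i where U: "U \<in> set_pmf (pa_tree (Suc t))" and i: "i \<in> set_pmf (attach (Suc t) U)"
    and T: "T = add_mini_vertex (Suc (Suc t)) U i" by auto
  note IH = 3(1)[OF U]
  have i': "i \<in> {1..Suc (Suc t)}"
  proof (rule ccontr)
    assume "i \<notin> {1..Suc (Suc t)}"
    then have "pmf (attach (Suc t) U) i = 0" by (subst pmf_attach_aux) (use IH in auto)
    with i show False by (simp add: set_pmf_iff)
  qed
  have "(\<Sum>s\<in>{1..Suc (Suc t)}. deg T s) = (\<Sum>s\<in>{1..Suc (Suc t)}. deg U s) + 2"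
    using i' by (simp only: T deg_add_mini_vertex sum.distrib sum.delta) auto
  also have "(\<Sum>s\<in>{1..Suc (Suc t)}. deg U s) = 2 * Suc t"
    using IH by simp
  finally have "(\<Sum>s\<in>{1..Suc (Suc t)}. deg T s) = 2 * Suc (Suc t)" by simp
  moreover have "verts T = {1..Suc (Suc t)}" "size (edges T) = Suc (Suc t)"
    using IH by (auto simp: T add_mini_vertex_def)
  moreover have "\<forall>s. s \<notin> {1..Suc (Suc t)} \<longrightarrow> deg T s = 0"
    using IH i' by (auto simp: T deg_add_mini_vertex)
  ultimately show ?case by blast
qed

lemma pa_tree'_invar:
  "T \<in> set_pmf (pa_tree' t) \<Longrightarrow>
     verts T = {1..t} \<and> size (edges T) = t \<and> (\<forall>s. s \<notin> {1..t} \<longrightarrow> deg T s = 0)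
     \<and> (\<Sum>s\<in>{1..t}. deg T s) = 2 * t - 1"
proof (induction t arbitrary: T rule: pa_tree'.induct)
  case 1
  then show ?case by (simp add: deg_def)
next
  case 2
  then show ?case by (simp add: deg_def)
next
  case (3 t)
  from 3(2) obtain U i where U: "U \<in> set_pmf (pa_tree' (Suc t))" and i: "i \<in> set_pmf (attach' (Suc t) U)"
    and T: "T = add_mini_vertex (Suc (Suc t)) U i" by auto
  note IH = 3(1)[OF U]
  have i': "i \<in> {1..Suc t}"
  proof (rule ccontr)
    assume "i \<notin> {1..Suc t}"
    then have "pmf (attach' (Suc t) U) i = 0" by (subst pmf_attach'_aux) (use IH in auto)
    with i show False by (simp add: set_pmf_iff)
  qed
  have "(\<Sum>s\<in>{1..Suc (Suc t)}. deg T s) = (\<Sum>s\<in>{1..Suc (Suc t)}. deg U s) + 2"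
    using i' by (simp only: T deg_add_mini_vertex sum.distrib sum.delta) auto
  also have "(\<Sum>s\<in>{1..Suc (Suc t)}. deg U s) = 2 * Suc t - 1"
    using IH by simp
  finally have "(\<Sum>s\<in>{1..Suc (Suc t)}. deg T s) = 2 * Suc (Suc t) - 1" by simp
  moreover have "verts T = {1..Suc (Suc t)}" "size (edges T) = Suc (Suc t)"
    using IH by (auto simp: T add_mini_vertex_def)
  moreover have "\<forall>s. s \<notin> {1..Suc (Suc t)} \<longrightarrow> deg T s = 0"
    using IH i' by (auto simp: T deg_add_mini_vertex)
  ultimately show ?case by blast
qed

lemma pmf_attach:
  assumes "T \<in> set_pmf (pa_tree t)"
  shows "pmf (attach t T) s = (if s \<in> {1..t} then real (deg T s) / (2 * real t + 1)
                               else if s = t + 1 then 1 / (2 * real t + 1) else 0)"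
  using pa_tree_invar[OF assms] by (intro pmf_attach_aux) simp

lemma pmf_attach':
  assumes "T \<in> set_pmf (pa_tree' t)" "t \<ge> 1"
  shows "pmf (attach' t T) s = (if s \<in> {1..t} then real (deg T s) / (2 * real t - 1) else 0)"
  using pa_tree'_invar[OF assms(1)] assms(2) by (intro pmf_attach'_aux) simp

end

theory Submission
  imports Defs "HOL-Real_Asymp.Real_Asymp"
begin

text \<open>
  Modularity above \<open>0.92383\<close> forces a sparse balanced cut, and a preferential attachment graph has
  such a cut only with exponentially small probability.

  For the first part, the summand \<open>e(S) / m - (vol S / vol V)\<^sup>2\<close> of the modularity score is a quadratic
  set function. Distributing the parts of a partition over two sides therefore loses at most half of
  the score if it is done well (\<open>half_modularity_score_split\<close>). A split of the vertex set in two with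
  score above \<open>0.461915\<close> cuts fewer than \<open>1/26\<close> of the edges, and either side has a share of at least
  \<open>0.362\<close> of the volume (\<open>balanced_sparse_cut_if_modularity_large\<close>).

  For the second part, let \<open>m = h * n\<close> and fix a colouring of the mini-vertices with two colours. Up
  to a lower order term, the probability that an edge stays within the colour of its new mini-vertex
  is the share of that colour in the volume. This is a Polya urn, perturbed by the cut edges. If
  \<open>i\<close> and \<open>j\<close> edges lie inside the two colour classes and \<open>b\<close> edges are cut, then the volume of the first class is
  about \<open>2 * i + b\<close>, and estimating the probability of each cut edge by 1 gives the bound
  \<open>(m choose b) * (m choose d) / (m choose (i + d))\<close> with \<open>d = b div 2\<close> for the probability of this
  outcome, up to polynomial factors (\<open>prob_profile_le\<close>). For a sparse balanced cut the denominator is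
  only smaller than \<open>2 ^ m\<close> by a factor of about \<open>(9/5) powr (m / 7)\<close> at most, and the two factors in the numerator are exponentials with small rates. As
  blocks of \<open>h \<ge> 2\<close> mini-vertices are merged, only \<open>2 ^ n \<le> 2 powr (m / 2)\<close> colourings matter. The product of all these
  factors still decays exponentially (\<open>rate_less_1\<close>), so a union bound finishes the proof.
\<close>

section \<open>From partitions to balanced sparse cuts\<close>

text \<open>
  The edges that occur in both models: the special loop has one endpoint, every other edge two,
  which may coincide.
\<close>
definition edge_like :: "'v multiset \<Rightarrow> bool" where
  "edge_like e \<longleftrightarrow> (\<exists>u v. e = {#u#} \<or> e = {#u, v#})"

text \<open>
  The hypothesis on \<open>f\<close> says that \<open>M X Y = f (X \<union> Y) - f X - f Y\<close> is additive in each argument on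
  disjoint sets. For such a function the members of \<open>P\<close> can be distributed greedily over two sides
  \<open>U\<close> and \<open>W\<close>: when a new member \<open>A\<close> arrives, it joins the side with the larger \<open>M\<close>, which is at
  least the average \<open>M (U \<union> W) A / 2\<close>. In the end at least half of the total interaction between
  members of \<open>P\<close> lies within the sides.
\<close>

lemma quadratic_set_function_split:
  fixes f :: "'a set \<Rightarrow> real"
  assumes quadratic: "\<And>X Y Z. X \<subseteq> V \<Longrightarrow> Y \<subseteq> V \<Longrightarrow> Z \<subseteq> V \<Longrightarrow> X \<inter> Y = {} \<Longrightarrow> X \<inter> Z = {} \<Longrightarrow> Y \<inter> Z = {} \<Longrightarrow>
      f (X \<union> Y \<union> Z) + f X + f Y + f Z = f (X \<union> Y) + f (X \<union> Z) + f (Y \<union> Z)"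
    and empty: "f {} = 0"
    and "finite P" "disjoint P" "\<Union>P \<subseteq> V"
  shows "\<exists>U W. U \<inter> W = {} \<and> U \<union> W = \<Union>P \<and> f U + f W \<ge> (f (\<Union>P) + (\<Sum>S\<in>P. f S)) / 2"
  using assms(3,4,5)
proof (induction P rule: finite_induct)
  case empty
  show ?case by (intro exI[of _ "{}"]) (simp add: assms(2))
next
  case (insert A P)
  have "disjoint P" using insert.prems(1) by (auto simp: disjoint_def)
  then obtain U W where UW: "U \<inter> W = {}" "U \<union> W = \<Union>P"
    and ge: "f U + f W \<ge> (f (\<Union>P) + (\<Sum>S\<in>P. f S)) / 2"
    using insert by auto
  have "A \<inter> \<Union>P = {}"
    using insert.prems(1) insert.hyps(2) by (fastforce simp: disjoint_def)
  then have A: "U \<inter> A = {}" "W \<inter> A = {}" using UW(2) by blast+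
  have sub: "U \<subseteq> V" "W \<subseteq> V" "A \<subseteq> V" using UW(2) insert.prems(2) by blast+
  have eq: "f (\<Union>(insert A P)) + f U + f W + f A = f (\<Union>P) + f (U \<union> A) + f (W \<union> A)"
    using quadratic[OF sub UW(1) A] UW(2) by (simp add: Un_commute)
  have s: "(\<Sum>S\<in>insert A P. f S) = f A + (\<Sum>S\<in>P. f S)" using insert by simp
  \<comment> \<open>The two choices for \<open>A\<close> have an average that equals the required bound, so one of them reaches it.\<close>
  have "f (U \<union> A) + f W \<ge> (f (\<Union>(insert A P)) + (\<Sum>S\<in>insert A P. f S)) / 2
      \<or> f U + f (W \<union> A) \<ge> (f (\<Union>(insert A P)) + (\<Sum>S\<in>insert A P. f S)) / 2"
    using eq s ge by argo
  then show ?case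
  proof
    assume "f (U \<union> A) + f W \<ge> (f (\<Union>(insert A P)) + (\<Sum>S\<in>insert A P. f S)) / 2"
    then show ?thesis using A UW by (intro exI[of _ "U \<union> A"] exI[of _ W]) auto
  next
    assume "f U + f (W \<union> A) \<ge> (f (\<Union>(insert A P)) + (\<Sum>S\<in>insert A P. f S)) / 2"
    then show ?thesis using A UW by (intro exI[of _ U] exI[of _ "W \<union> A"]) auto
  qed
qed

text \<open>
  An edge has at most two endpoints, so three disjoint sets never share one: inclusion-exclusion
  stops at pairs.
\<close>

lemma num_edges_in_quadratic:
  assumes "\<forall>e\<in>#edges G. edge_like e" "X \<inter> Y = {}" "X \<inter> Z = {}" "Y \<inter> Z = {}"
  shows "num_edges_in G (X \<union> Y \<union> Z) + num_edges_in G X + num_edges_in G Y + num_edges_in G Z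
       = num_edges_in G (X \<union> Y) + num_edges_in G (X \<union> Z) + num_edges_in G (Y \<union> Z)"
proof -
  have "size (filter_mset (\<lambda>e. set_mset e \<subseteq> X \<union> Y \<union> Z) M) + size (filter_mset (\<lambda>e. set_mset e \<subseteq> X) M)
      + size (filter_mset (\<lambda>e. set_mset e \<subseteq> Y) M) + size (filter_mset (\<lambda>e. set_mset e \<subseteq> Z) M)
      = size (filter_mset (\<lambda>e. set_mset e \<subseteq> X \<union> Y) M) + size (filter_mset (\<lambda>e. set_mset e \<subseteq> X \<union> Z) M)
      + size (filter_mset (\<lambda>e. set_mset e \<subseteq> Y \<union> Z) M)"
    if "\<forall>e\<in>#M. edge_like e" for M
    using that
  proof (induction M)
    case (add e M)
    then obtain u v where "e = {#u#} \<or> e = {#u, v#}" by (auto simp: edge_like_def)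
    moreover have "w \<in> X \<Longrightarrow> w \<notin> Y" "w \<in> X \<Longrightarrow> w \<notin> Z" "w \<in> Y \<Longrightarrow> w \<notin> Z" for w
      using assms(2-4) by auto
    ultimately show ?case
      using add by (elim disjE; cases "u \<in> X"; cases "u \<in> Y"; cases "u \<in> Z"; simp)
  qed simp
  then show ?thesis using assms(1) by (auto simp: num_edges_in_def)
qed

lemma num_edges_in_plus_compl_le:
  assumes "\<forall>e\<in>#edges G. edge_like e"
  shows "num_edges_in G S + num_edges_in G (- S) \<le> num_edges G"
proof -
  have "size (filter_mset (\<lambda>e. set_mset e \<subseteq> S) M) + size (filter_mset (\<lambda>e. set_mset e \<subseteq> - S) M) \<le> size M"
    if "\<forall>e\<in>#M. edge_like e" for M
    using that by (induction M) (auto simp: edge_like_def)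
  then show ?thesis using assms by (simp add: num_edges_in_def num_edges_def)
qed

text \<open>
  An edge inside \<open>S\<close> contributes at most 2 to the volume of \<open>S\<close>, an edge inside the complement nothing,
  and a cut edge exactly 1. With \<open>i\<close> edges inside, \<open>j\<close> outside and \<open>b\<close> cut edges this gives the bound
  \<open>2 * i + b\<close> for the volume, written here without the cut edges. Equality
  fails only if a special loop lies inside \<open>S\<close>.
\<close>

lemma vol_plus_num_edges_in_compl_le:
  assumes "\<forall>e\<in>#edges G. edge_like e \<and> set_mset e \<subseteq> V" "finite V"
  shows "vol G (S \<inter> V) + num_edges_in G (- S) \<le> num_edges_in G S + num_edges G"
proof -
  have "(\<Sum>v\<in>S \<inter> V. \<Sum>e\<in>#M. count e v) + size (filter_mset (\<lambda>e. set_mset e \<subseteq> - S) M)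
      \<le> size (filter_mset (\<lambda>e. set_mset e \<subseteq> S) M) + size M"
    if "\<forall>e\<in>#M. edge_like e \<and> set_mset e \<subseteq> V" for M
    using that
  proof (induction M)
    case (add e M)
    from add.prems obtain u v where e: "e = {#u#} \<or> e = {#u, v#}" by (auto simp: edge_like_def)
    have one: "(\<Sum>x\<in>S \<inter> V. if w = x then Suc 0 else 0) = (if w \<in> S \<inter> V then 1 else 0)" for w
      using assms(2) by simp
    have "count {#u, v#} x = (if u = x then Suc 0 else 0) + (if v = x then Suc 0 else 0)" for x by simp
    then have two: "(\<Sum>x\<in>S \<inter> V. count {#u, v#} x)
        = (\<Sum>x\<in>S \<inter> V. if u = x then Suc 0 else 0) + (\<Sum>x\<in>S \<inter> V. if v = x then Suc 0 else 0)"
      by (simp only: sum.distrib)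
    have single: "(\<Sum>x\<in>S \<inter> V. count {#u#} x) = (\<Sum>x\<in>S \<inter> V. if u = x then Suc 0 else 0)"
      by (rule sum.cong) auto
    have "(\<Sum>x\<in>S \<inter> V. count e x) + (if set_mset e \<subseteq> - S then 1 else 0) \<le> (if set_mset e \<subseteq> S then 1 else 0) + 1"
      using e add.prems two single one[of u] one[of v] by (elim disjE) (simp_all split: if_splits)
    moreover have "(\<Sum>v\<in>S \<inter> V. \<Sum>e\<in>#add_mset e M. count e v)
        = (\<Sum>x\<in>S \<inter> V. count e x) + (\<Sum>v\<in>S \<inter> V. \<Sum>e\<in>#M. count e v)"
      by (simp add: sum.distrib)
    ultimately show ?case using add by (simp split: if_splits)
  qed simp
  then show ?thesis using assms(1) by (simp add: num_edges_in_def num_edges_def vol_def deg_def)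
qed

lemma num_edges_in_full:
  "(\<forall>e\<in>#edges G. set_mset e \<subseteq> V) \<Longrightarrow> num_edges_in G V = num_edges G"
  by (metis (no_types, lifting) filter_mset_True filter_mset_cong num_edges_def num_edges_in_def)

lemma vol_full:
  assumes "\<forall>e\<in>#edges G. set_mset e \<subseteq> V" "finite V"
  shows "vol G V = (\<Sum>e\<in>#edges G. size e)"
proof -
  have "(\<Sum>v\<in>V. \<Sum>e\<in>#M. count e v) = (\<Sum>e\<in>#M. size e)" if "\<forall>e\<in>#M. set_mset e \<subseteq> V" for M
    using that
  proof (induction M)
    case (add e M)
    have "(\<Sum>v\<in>V. count e v) = size e"
      unfolding size_multiset_overloaded_eq
      using add.prems assms(2) by (intro sum.mono_neutral_right) (auto simp: not_in_iff)
    then show ?case using add by (simp add: sum.distrib)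
  qed simp
  then show ?thesis using assms(1) by (simp add: vol_def deg_def)
qed

lemma vol_disjoint_Un:
  "finite A \<Longrightarrow> finite B \<Longrightarrow> A \<inter> B = {} \<Longrightarrow> vol G (A \<union> B) = vol G A + vol G B"
  by (simp add: vol_def sum.union_disjoint)

text \<open>
  The summand of the modularity score is a quadratic set function that vanishes on the whole vertex
  set, so a partition into two parts always reaches half of the score of any given partition.
\<close>

lemma half_modularity_score_split:
  fixes G :: "'v multigraph"
  defines "f \<equiv> \<lambda>S. real (num_edges_in G S) / real (num_edges G) - (real (vol G S) / real (vol G (verts G)))\<^sup>2"
  assumes edges: "\<forall>e\<in>#edges G. edge_like e \<and> set_mset e \<subseteq> verts G"
    and fin: "finite (verts G)" and pos: "num_edges G > 0" "vol G (verts G) > 0"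
    and P: "partition_on (verts G) P"
  shows "\<exists>U\<subseteq>verts G. f U + f (verts G - U) \<ge> modularity_score G P / 2"
proof -
  let ?V = "verts G"
  have quad: "f (X \<union> Y \<union> Z) + f X + f Y + f Z = f (X \<union> Y) + f (X \<union> Z) + f (Y \<union> Z)"
    if "X \<subseteq> ?V" "Y \<subseteq> ?V" "Z \<subseteq> ?V" "X \<inter> Y = {}" "X \<inter> Z = {}" "Y \<inter> Z = {}" for X Y Z
  proof -
    have fi: "finite X" "finite Y" "finite Z" using that fin finite_subset by blast+
    have "real (num_edges_in G (X \<union> Y \<union> Z)) + real (num_edges_in G X) + real (num_edges_in G Y) + real (num_edges_in G Z)
       = real (num_edges_in G (X \<union> Y)) + real (num_edges_in G (X \<union> Z)) + real (num_edges_in G (Y \<union> Z))"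
      using num_edges_in_quadratic[of G X Y Z] edges that unfolding of_nat_add[symmetric] by metis
    then have e: "real (num_edges_in G (X \<union> Y \<union> Z)) / num_edges G + real (num_edges_in G X) / num_edges G
        + real (num_edges_in G Y) / num_edges G + real (num_edges_in G Z) / num_edges G
       = real (num_edges_in G (X \<union> Y)) / num_edges G + real (num_edges_in G (X \<union> Z)) / num_edges G
        + real (num_edges_in G (Y \<union> Z)) / num_edges G"
      by (simp only: add_divide_distrib[symmetric])
    have v: "vol G (X \<union> Y) = vol G X + vol G Y" "vol G (X \<union> Z) = vol G X + vol G Z"
      "vol G (Y \<union> Z) = vol G Y + vol G Z" "vol G (X \<union> Y \<union> Z) = vol G X + vol G Y + vol G Z"
      using fi that by (auto simp: vol_disjoint_Un Int_Un_distrib2)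
    show ?thesis
      unfolding f_def v using e by (simp add: add_divide_distrib power2_eq_square algebra_simps)
  qed
  have full: "f ?V = 0"
    using num_edges_in_full[of G ?V] edges pos by (simp add: f_def)
  have empty: "f {} = 0"
  proof -
    have "filter_mset (\<lambda>e. set_mset e \<subseteq> {}) (edges G) = {#}"
      using edges by (auto simp: edge_like_def)
    then show ?thesis by (simp add: f_def num_edges_in_def vol_def)
  qed
  obtain U W where UW: "U \<inter> W = {}" "U \<union> W = \<Union>P" "f U + f W \<ge> (f (\<Union>P) + (\<Sum>S\<in>P. f S)) / 2"
    using quadratic_set_function_split[of ?V f P] quad empty P fin
    by (metis finite_elements partition_onD1 partition_onD2 order_refl)
  have "W = ?V - U" "U \<subseteq> ?V" "\<Union>P = ?V" using UW P by (auto simp: partition_on_def)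
  then show ?thesis using UW(3) full by (intro exI[of _ U]) (simp add: modularity_score_def f_def)
qed

text \<open>
  Let \<open>y\<close> be the share of the volume that lies in \<open>U\<close>. A split with at least half of the score
  \<open>0.92383\<close> satisfies \<open>(i + j) / m - y\<^sup>2 - (1 - y)\<^sup>2 \<ge> 0.461915\<close>. As \<open>y\<^sup>2 + (1 - y)\<^sup>2\<close> is at least \<open>1/2\<close>,
  the cut contains at most a fraction \<open>0.038085 < 1/26\<close> of the edges. As \<open>(i + j) / m\<close> is at most 1
  and \<open>y\<^sup>2 + (1 - y)\<^sup>2 = 1/2 + 2 * (y - 1/2)\<^sup>2\<close>, the split is balanced, \<open>\<bar>y - 1/2\<bar> \<le> 0.138\<close>. Balance
  is stated as a lower bound for the upper bounds \<open>m + i - j\<close> and \<open>m + j - i\<close> of the two volumes,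
  because only the edge counts \<open>i\<close> and \<open>j\<close> are tracked along the process.
\<close>

lemma balanced_sparse_cut_if_modularity_large:
  fixes G :: "'v multigraph"
  defines "m \<equiv> real (num_edges G)"
  assumes edges: "\<forall>e\<in>#edges G. edge_like e \<and> set_mset e \<subseteq> verts G"
    and fin: "finite (verts G)" and pos: "num_edges G > 0" and vol: "2 * m - 1 \<le> real (vol G (verts G))"
    and large: "\<not> modularity G \<le> 0.92383"
  shows "\<exists>U\<subseteq>verts G. let i = real (num_edges_in G U); j = real (num_edges_in G (- U)) in
           m - i - j \<le> m / 26 \<and> 181 / 500 * (2 * m - 1) \<le> m + i - j \<and> 181 / 500 * (2 * m - 1) \<le> m + j - i"
proof -
  let ?V = "verts G" and ?Q = "{modularity_score G P |P. partition_on (verts G) P}"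
  have "finite {P. partition_on ?V P}" using fin by (rule finitely_many_partition_on)
  then have finQ: "finite ?Q" by (simp add: setcompr_eq_image)
  have "\<exists>P. partition_on ?V P"
    using partition_on_space[of ?V] partition_on_empty by (cases "?V = {}") auto
  then have "?Q \<noteq> {}" by blast
  then obtain P where P: "partition_on ?V P" "modularity_score G P > 0.92383"
    using large finQ unfolding modularity_def by (subst (asm) Max_le_iff) auto
  have volpos: "vol G ?V > 0" using vol pos by (simp add: m_def)
  obtain U where U: "U \<subseteq> ?V" and
    f: "real (num_edges_in G U) / m - (real (vol G U) / real (vol G ?V))\<^sup>2
       + (real (num_edges_in G (?V - U)) / m - (real (vol G (?V - U)) / real (vol G ?V))\<^sup>2) \<ge> modularity_score G P / 2"
    using half_modularity_score_split[OF edges fin pos volpos P(1)] unfolding m_def by blast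
  define y where "y = real (vol G U) / real (vol G ?V)"
  have finU: "finite U" "finite (?V - U)" using U fin finite_subset by auto
  have Vsum: "vol G ?V = vol G U + vol G (?V - U)"
    using vol_disjoint_Un[OF finU] U by (simp add: Un_absorb1)
  have y': "real (vol G (?V - U)) / real (vol G ?V) = 1 - y"
    
    using volpos by (simp add: y_def Vsum field_simps flip: of_nat_add)
  have eW: "num_edges_in G (?V - U) = num_edges_in G (- U)"
    unfolding num_edges_in_def by (rule arg_cong[of _ _ size], rule filter_mset_cong) (use edges in auto)
  define i where "i = real (num_edges_in G U)"
  define j where "j = real (num_edges_in G (- U))"
  have m: "m > 0" using pos by (simp add: m_def)
  have key: "(i + j) / m - y\<^sup>2 - (1 - y)\<^sup>2 \<ge> 92383 / 200000"
  proof -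
    have "modularity_score G P / 2 \<ge> 92383 / 200000" using P(2) by simp
    then show ?thesis
      using f unfolding y' eW i_def[symmetric] j_def[symmetric] y_def[symmetric] add_divide_distrib by linarith
  qed
  have ij: "i + j \<le> m"
    using num_edges_in_plus_compl_le[of G U] edges unfolding i_def j_def m_def by auto
  have sq: "y\<^sup>2 + (1 - y)\<^sup>2 = 1/2 + 2 * (y - 1/2)\<^sup>2" by (simp add: power2_eq_square algebra_simps)
  have "(i + j) / m \<ge> 192383 / 200000" using key sq zero_le_power2[of "y - 1/2"] by linarith
  then have "i + j \<ge> 192383 / 200000 * m" using m by (simp add: pos_le_divide_eq)
  then have c1: "m - i - j \<le> m / 26" using m by simp
  have "(i + j) / m \<le> 1" using ij m by simp
  then have "(y - 1/2)\<^sup>2 \<le> 4761 / 250000" using key sq by linarith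
  then have "(y - 1/2)\<^sup>2 \<le> (69 / 500)\<^sup>2" by (simp add: power_divide)
  then have "\<bar>y - 1/2\<bar> \<le> 69 / 500" by (metis abs_le_square_iff abs_of_nonneg zero_le_divide_iff zero_le_numeral)
  then have yb: "181 / 500 \<le> y" "181 / 500 \<le> 1 - y" by (auto simp: abs_if split: if_splits)
  have W: "U \<inter> ?V = U" "- U \<inter> ?V = ?V - U" using U by auto
  have v1: "real (vol G U) \<le> m + i - j"
    using vol_plus_num_edges_in_compl_le[OF edges fin, of U] unfolding i_def j_def m_def W by simp
  have v2: "real (vol G (?V - U)) \<le> m + j - i"
    using vol_plus_num_edges_in_compl_le[OF edges fin, of "- U"] unfolding i_def j_def m_def W by simp
  have "181 / 500 * real (vol G ?V) \<le> real (vol G U)" "181 / 500 * real (vol G ?V) \<le> real (vol G (?V - U))"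
    using yb volpos unfolding y'[symmetric] unfolding y_def by (simp_all add: pos_le_divide_eq)
  moreover have "181 / 500 * (2 * m - 1) \<le> 181 / 500 * real (vol G ?V)"
    using vol by (rule mult_left_mono) simp
  ultimately have "181 / 500 * (2 * m - 1) \<le> m + i - j" "181 / 500 * (2 * m - 1) \<le> m + j - i"
    using v1 v2 by linarith+
  then show ?thesis using U c1 unfolding i_def j_def by (auto simp: Let_def)
qed

section \<open>Urn probabilities and binomial estimates\<close>

text \<open>
  A product over the \<open>i + j\<close> edges that stay within their colour: the \<open>l\<close>-th edge inside one class,
  arriving when \<open>l'\<close> edges lie inside the other, contributes \<open>(l + d) / (l + l' + d)\<close>. As in a Polya
  urn, the product does not depend on the order in which the two classes grow. The offset \<open>d\<close> stands
  for the volume that the cut edges add to a class, in units of 2.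
\<close>

definition cut_weight :: "nat \<Rightarrow> nat \<Rightarrow> nat \<Rightarrow> real" where
  "cut_weight i j d = fact (i + d) * fact (j + d) / (fact d * fact (i + j + d))"

lemma cut_weight_pos: "cut_weight i j d > 0"
  by (simp add: cut_weight_def)

lemma cut_weight_commute: "cut_weight i j d = cut_weight j i d"
  by (simp add: cut_weight_def add.commute mult.commute)

lemma cut_weight_0 [simp]: "cut_weight 0 j d = 1"
  by (simp add: cut_weight_def)

lemma cut_weight_Suc:
  "cut_weight (Suc i) j d = cut_weight i j d * (real (Suc i + d) / real (Suc i + j + d))"
  by (simp add: cut_weight_def divide_simps)

text \<open>
  This monotonicity lets a bound obtained with few cut edges be carried over when another edge is
  cut. It amounts to \<open>x * (i + j + x) \<le> (i + x) * (j + x)\<close>.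
\<close>

lemma cut_weight_mono:
  assumes "d \<le> d'"
  shows "cut_weight i j d \<le> cut_weight i j d'"
proof (rule lift_Suc_mono_le[OF _ assms])
  fix d
  have "cut_weight i j (Suc d) = cut_weight i j d *
      ((real (Suc (i + d)) * real (Suc (j + d))) / (real (Suc d) * real (Suc (i + j + d))))"
    by (simp add: cut_weight_def mult_ac)
  moreover have "Suc d * Suc (i + j + d) \<le> Suc (i + d) * Suc (j + d)"
    by (simp add: algebra_simps)
  then have "real (Suc d) * real (Suc (i + j + d)) \<le> real (Suc (i + d)) * real (Suc (j + d))"
    by (simp only: of_nat_mult[symmetric] of_nat_le_iff)
  then have "(real (Suc (i + d)) * real (Suc (j + d))) / (real (Suc d) * real (Suc (i + j + d))) \<ge> 1"
    by (subst le_divide_eq_1_pos) simp_all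
  ultimately show "cut_weight i j d \<le> cut_weight i j (Suc d)"
    using mult_left_mono[of 1 _ "cut_weight i j d"] cut_weight_pos[of i j d] by fastforce
qed

lemma cut_weight_eq_choose:
  "cut_weight i j d = real (i + j + 2 * d choose d) / real (i + j + 2 * d choose (i + d))"
proof -
  have diff: "i + j + 2 * d - d = i + j + d" "i + j + 2 * d - (i + d) = j + d" by simp_all
  have le: "d \<le> i + j + 2 * d" "i + d \<le> i + j + 2 * d" by simp_all
  have gen: "x / y = (n / y) / (n / x)" if "n \<noteq> 0" for x y n :: real
    using that by simp
  show ?thesis
    unfolding cut_weight_def binomial_fact[OF le(1)] binomial_fact[OF le(2)] diff
    by (rule gen) (rule fact_nonzero)
qed

text \<open>
  With \<open>t = i + j + b\<close> edges, \<open>b\<close> of them cut, the next edge stays in the first class with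
  probability about \<open>(2 * i + b + 1) / (2 * t + 1)\<close>. The denominator contains \<open>2 * b\<close> but the numerator
  only \<open>b\<close>, so replacing \<open>2 * b\<close> by \<open>b\<close> gives an urn with the fixed offset \<open>d = b div 2\<close>.
\<close>

lemma matched_step_le:
  assumes "b \<le> 2 * d + 1" "t = i + j + b"
  shows "cut_weight i j d * real (2 * i + b + 1) \<le> cut_weight (Suc i) j d * real (2 * t + 1)"
proof -
  have "(2 * i + b + 1) * (Suc i + j + d) \<le> (Suc i + d) * (2 * t + 1)"
  proof -
    have "j * (2 * i + b + 1) \<le> (Suc i + d) * (2 * j)"
      using mult_le_mono2[of "2 * i + b + 1" "2 * (Suc i + d)" j] assms(1) by (simp add: algebra_simps)
    then show ?thesis unfolding assms(2) by (simp add: algebra_simps)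
  qed
  then have "real (2 * i + b + 1) * real (Suc i + j + d) \<le> real (Suc i + d) * real (2 * t + 1)"
    by (simp only: of_nat_mult[symmetric] of_nat_le_iff)
  then have "real (2 * i + b + 1) \<le> real (Suc i + d) / real (Suc i + j + d) * real (2 * t + 1)"
    by (simp add: pos_le_divide_eq)
  from mult_left_mono[OF this, of "cut_weight i j d"] show ?thesis
    using cut_weight_pos[of i j d] by (simp add: cut_weight_Suc mult.assoc)
qed

text \<open>
  A single term of the expansion of \<open>(1 + 1 / x) ^ n\<close>; the choice \<open>x = (n - k) / k\<close> gives the entropy
  bound for the binomial coefficient.
\<close>

lemma choose_le_tilted:
  fixes x :: real
  assumes "x > 0"
  shows "real (n choose k) \<le> x ^ k * ((x + 1) / x) ^ n"
proof (cases "k \<le> n")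
  case True
  have "real (n choose k) * (1 / x) ^ k \<le> (\<Sum>k\<le>n. real (n choose k) * (1 / x) ^ k)"
    using True assms by (intro member_le_sum) auto
  also have "\<dots> = (1 / x + 1) ^ n"
    by (subst binomial_ring) simp
  also have "1 / x + 1 = (x + 1) / x" using assms by (simp add: field_simps)
  finally show ?thesis using assms by (simp add: field_simps)
qed (use assms in \<open>simp add: binomial_eq_0\<close>)

lemma central_choose_ge: "2 ^ n / (real n + 1) \<le> real (n choose (n div 2))"
proof -
  have "(2::nat) ^ n \<le> (\<Sum>k\<le>n. n choose (n div 2))"
    unfolding choose_row_sum[symmetric] by (intro sum_mono binomial_maximum)
  then have "(2::nat) ^ n \<le> (n + 1) * (n choose (n div 2))" by simp
  then have "real (2 ^ n) \<le> real ((n + 1) * (n choose (n div 2)))" by (simp only: of_nat_le_iff)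
  then show ?thesis by (simp add: pos_divide_le_eq algebra_simps)
qed

text \<open>
  Between \<open>5 * n / 14\<close> and the middle, consecutive binomial coefficients differ by a factor of at most
  \<open>9/5\<close>, and there are at most \<open>n / 7\<close> steps.
\<close>

lemma choose_ge_near_middle:
  assumes "5 * n \<le> 14 * k" "14 * k \<le> 9 * n"
  shows "(5 / 9) powr (real n / 7) * 2 ^ n / (real n + 1) \<le> real (n choose k)"
proof -
  have below: "(5 / 9) ^ s * real (n choose (n div 2)) \<le> real (n choose k)"
    if "5 * n \<le> 14 * k" "k + s = n div 2" for k s
    using that
  proof (induction s arbitrary: k)
    case (Suc s)
    have k: "k < n" using Suc.prems by linarith
    have "Suc k * (n choose Suc k) = (n - k) * (n choose k)"
      by (metis binomial_absorb_comp binomial_absorption)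
    then have eq: "real (Suc k) * real (n choose Suc k) = real (n - k) * real (n choose k)"
      by (metis of_nat_mult)
    have "5 * n \<le> 14 * k" using Suc.prems(1) .
    then have "real (5 * n) \<le> real (14 * k)" by (simp only: of_nat_le_iff)
    then have "5 / 9 * real (n - k) \<le> real (Suc k)" using k by (simp add: of_nat_diff)
    then have "5 / 9 * real (n - k) * real (n choose Suc k) \<le> real (n - k) * real (n choose k)"
      unfolding eq[symmetric] by (rule mult_right_mono) simp
    then have "real (n - k) * (5 / 9 * real (n choose Suc k)) \<le> real (n - k) * real (n choose k)"
      by (simp only: mult_ac)
    then have "5 / 9 * real (n choose Suc k) \<le> real (n choose k)"
      by (rule mult_left_le_imp_le) (use k in simp)
    moreover have "(5 / 9) ^ s * real (n choose (n div 2)) \<le> real (n choose Suc k)"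
      using Suc.prems by (intro Suc.IH) auto
    ultimately show ?case by simp
  qed simp
  have low: "(5 / 9) powr (real n / 7) * 2 ^ n / (real n + 1) \<le> real (n choose k)"
    if "5 * n \<le> 14 * k" "k \<le> n div 2" for k
  proof -
    define s where "s = n div 2 - k"
    have "real s \<le> real n / 7" using that unfolding s_def by linarith
    then have "(5 / 9 :: real) powr (real n / 7) \<le> (5 / 9) powr real s" by (intro powr_mono') auto
    then have "(5 / 9 :: real) powr (real n / 7) \<le> (5 / 9) ^ s" by (simp add: powr_realpow)
    then have "(5 / 9) powr (real n / 7) * (2 ^ n / (real n + 1)) \<le> (5 / 9) ^ s * real (n choose (n div 2))"
      by (intro mult_mono central_choose_ge) auto
    also have "\<dots> \<le> real (n choose k)" using that by (intro below) (auto simp: s_def)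
    finally show ?thesis by simp
  qed
  show ?thesis
  proof (cases "k \<le> n div 2")
    case True
    then show ?thesis using low assms by blast
  next
    case False
    have "k \<le> n" using assms by linarith
    then have "n choose k = n choose (n - k)" by (rule binomial_symmetric)
    moreover have "5 * n \<le> 14 * (n - k)" "n - k \<le> n div 2" using assms False by linarith+
    ultimately show ?thesis using low[of "n - k"] by simp
  qed
qed

text \<open>
  The exponential rate of the union bound per mini-vertex. The factors come, in this order, from
  choosing the cut edges among all edges (\<open>m choose b\<close> with \<open>b \<le> m / 26\<close>), from the numerator
  \<open>M choose (b div 2)\<close> of \<open>cut_weight\<close> and from the distance of its denominator from the central
  binomial coefficient. That coefficient contributes \<open>1 / 2\<close>, and the at most \<open>2 powr (m / 2)\<close>
  colourings leave \<open>1 / 2 powr (1/2)\<close>.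
\<close>
definition rate :: real where
  "rate = 25 powr (1/26) * (26/25) * 51 powr (1/52) * (52/51) * (9/5) powr (1/7) / 2 powr (1/2)"

lemma rate_pos: "rate > 0" by (simp add: rate_def)

text \<open>
  The power 364, the least common multiple of 26, 52, 7 and 2, makes all exponents integral. The
  logarithm of \<open>rate\<close> is about \<open>-0.0045\<close>, so the 364th power is about \<open>0.19\<close>, which leaves room
  for rounding.
\<close>

lemma rate_less_1: "rate < 1"
proof (rule ccontr)
  have pw: "(x powr (1 / c)) ^ 364 = x ^ l" if "x > 0" "364 = c * real l" for x c :: real and l :: nat
  proof -
    have "c \<noteq> 0" using that by auto
    have "(x powr (1 / c)) ^ 364 = x powr (1 / c * 364)"
      using that(1) by (subst powr_power) auto
    also have "1 / c * 364 = real l"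
      unfolding that(2) using \<open>c \<noteq> 0\<close> by simp
    finally show ?thesis using that(1) by (simp add: powr_realpow)
  qed
  have pws: "(25 powr (1/26)) ^ 364 = (25::real) ^ 14" "(51 powr (1/52)) ^ 364 = (51::real) ^ 7"
    "((9/5) powr (1/7)) ^ 364 = (9/5 :: real) ^ 52" "(2 powr (1/2)) ^ 364 = (2::real) ^ 182"
    by (rule pw; simp)+
  have regroup: "a ^ 14 * b ^ 364 * c ^ 7 * d ^ 364 * e ^ 52 / f ^ 182 = (a ^ 2 * c * (b * d) ^ 52 / f ^ 26) ^ 7 * e ^ 52"
    for a b c d e f :: real
    by (simp add: power_mult_distrib power_divide power_mult[symmetric])
  have "rate ^ 364 = 25 ^ 14 * (26/25) ^ 364 * 51 ^ 7 * (52/51) ^ 364 * (9/5) ^ 52 / 2 ^ 182"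
    unfolding rate_def power_mult_distrib power_divide[of _ "2 powr (1/2)"] pws ..
  also have "\<dots> = (25 ^ 2 * 51 * (26/25 * (52/51)) ^ 52 / 2 ^ 26) ^ 7 * (9/5) ^ 52"
    by (rule regroup)
  \<comment> \<open>The inner base is about \<open>0.01002\<close>; rounding it up to \<open>1/95\<close> keeps the numbers small.\<close>
  also have "\<dots> \<le> (1 / 95) ^ 7 * (9/5) ^ 52"
  proof (intro mult_right_mono power_mono)
    have "(1352::real) ^ 52 \<le> 22 * 1275 ^ 52" by simp
    then have "(1352::real) ^ 52 / 1275 ^ 52 \<le> 22"
      by (subst pos_divide_le_eq) (rule zero_less_power, rule zero_less_numeral)
    moreover have "(26/25 * (52/51) :: real) = 1352 / 1275" by simp
    ultimately have "(26/25 * (52/51) :: real) ^ 52 \<le> 22" by (simp only: power_divide)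
    then have "25 ^ 2 * 51 * (26/25 * (52/51)) ^ 52 / 2 ^ 26 \<le> (25 ^ 2 * 51 * 22 / 2 ^ 26 :: real)"
      by (intro divide_right_mono mult_left_mono) (simp_all only: zero_le_power zero_le_numeral zero_le_mult_iff simp_thms)
    also have "\<dots> \<le> 1 / 95" by simp
    finally show "25 ^ 2 * 51 * (26/25 * (52/51)) ^ 52 / 2 ^ 26 \<le> (1 / 95 :: real)" .
  qed (rule zero_le_power divide_nonneg_nonneg mult_nonneg_nonneg zero_le_numeral)+
  also have "(1 / 95) ^ 7 * (9/5) ^ 52 < (1::real)"
  proof -
    have "(9::real) ^ 52 < 95 ^ 7 * 5 ^ 52" by simp
    then have "(9::real) ^ 52 / (95 ^ 7 * 5 ^ 52) < 1"
      by (subst divide_less_eq_1_pos) (simp_all only: zero_less_power mult_pos_pos zero_less_numeral)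
    then show ?thesis by (simp only: power_divide power_one times_divide_times_eq mult_1)
  qed
  finally have "rate ^ 364 < 1" .
  moreover assume "\<not> rate < 1"
  then have "rate ^ 364 \<ge> 1" by (intro one_le_power) (rule leI)
  ultimately show False by (meson leD)
qed

lemma powr_div_eq_power:
  assumes "x > 0"
  shows "(x::real) powr (real n / c) = (x powr (1 / c)) ^ n"
  using assms by (subst powr_power) auto

text \<open>
  The bound for the probability of one profile of a sparse and balanced cut, up to a polynomial
  factor. Dividing \<open>rate ^ m\<close> by \<open>2 powr (m / 2)\<close> leaves exactly the room for summing over all
  colourings.
\<close>

lemma cut_profile_count_le:
  assumes m: "i + j + b = m" and b: "26 * b \<le> m"
    and balanced: "5 * m \<le> 14 * (i + b div 2)" "5 * m \<le> 14 * (j + b div 2)"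
  shows "real (m choose b) * cut_weight i j (b div 2) \<le> 2 * (real m + 1) * (rate ^ m / 2 powr (real m / 2))"
proof -
  define d where "d = b div 2"
  \<comment> \<open>\<open>M\<close> is \<open>m\<close> or \<open>m - 1\<close>, according to the parity of \<open>b\<close>.\<close>
  define M where "M = i + j + 2 * d"
  have M: "M \<le> m" "m \<le> M + 1" unfolding M_def d_def using m by linarith+
  have c1: "real (m choose b) \<le> 25 powr (real m / 26) * (26/25) ^ m"
  proof -
    have "real (m choose b) \<le> 25 ^ b * ((25 + 1) / 25) ^ m" by (rule choose_le_tilted) simp
    also have "(25::real) ^ b = 25 powr real b" by (simp add: powr_realpow)
    also have "(25::real) powr real b \<le> 25 powr (real m / 26)" using b by (intro powr_mono) auto
    finally show ?thesis by simp
  qed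
  have c2: "real (M choose d) \<le> 51 powr (real m / 52) * (52/51) ^ m"
  proof -
    have "real (M choose d) \<le> 51 ^ d * ((51 + 1) / 51) ^ M" by (rule choose_le_tilted) simp
    also have "(51::real) ^ d = 51 powr real d" by (simp add: powr_realpow)
    also have "(51::real) powr real d \<le> 51 powr (real m / 52)"
      using b unfolding d_def by (intro powr_mono) linarith+
    also have "((51 + 1) / 51 :: real) ^ M \<le> ((51 + 1) / 51) ^ m" using M by (intro power_increasing) auto
    finally show ?thesis by simp
  qed
  have c3: "(5 / 9) powr (real m / 7) * 2 ^ m / (2 * (real m + 1)) \<le> real (M choose (i + d))"
  proof -
    have "(5 / 9 :: real) powr (real m / 7) \<le> (5 / 9) powr (real M / 7)"
      using M by (intro powr_mono') auto
    moreover have "(2::real) ^ m \<le> 2 * 2 ^ M"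
      using M power_increasing[of m "M + 1" "2::real"] by simp
    ultimately have "(5 / 9) powr (real m / 7) * 2 ^ m / (2 * (real m + 1))
        \<le> (5 / 9) powr (real M / 7) * (2 * 2 ^ M) / (2 * (real M + 1))"
      using M by (intro frac_le mult_mono) auto
    also have "\<dots> = (5 / 9) powr (real M / 7) * 2 ^ M / (real M + 1)" by (simp add: field_simps)
    also have "\<dots> \<le> real (M choose (i + d))"
    proof (rule choose_ge_near_middle)
      show "5 * M \<le> 14 * (i + d)" "14 * (i + d) \<le> 9 * M"
        using balanced[folded d_def] M unfolding M_def by simp_all
    qed
    finally show ?thesis .
  qed
  have pos: "(5 / 9) powr (real m / 7) * 2 ^ m / (2 * (real m + 1)) > (0::real)" by simp
  have "real (m choose b) * cut_weight i j d = real (m choose b) * real (M choose d) / real (M choose (i + d))"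
    by (simp add: cut_weight_eq_choose M_def)
  also have "\<dots> \<le> (25 powr (real m / 26) * (26/25) ^ m) * (51 powr (real m / 52) * (52/51) ^ m)
      / ((5 / 9) powr (real m / 7) * 2 ^ m / (2 * (real m + 1)))"
    using c1 c2 c3 pos by (intro frac_le mult_mono) auto
  also have "\<dots> = 2 * (real m + 1) * (rate ^ m / 2 powr (real m / 2))"
  proof -
    have two: "(2::real) ^ m = 2 powr (real m / 2) * 2 powr (real m / 2)"
      by (simp add: powr_add[symmetric] powr_realpow)
    have inv: "(9 / 5 :: real) powr (real m / 7) = 1 / (5 / 9) powr (real m / 7)"
      by (simp add: powr_divide)
    have r: "rate ^ m = 25 powr (real m / 26) * (26/25) ^ m * 51 powr (real m / 52) * (52/51) ^ m
        * (9/5) powr (real m / 7) / 2 powr (real m / 2)"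
      unfolding rate_def power_mult_distrib power_divide[of _ "2 powr (1/2)"]
      by (simp only: powr_div_eq_power)
    show ?thesis unfolding r inv two by (simp add: field_simps)
  qed
  finally show ?thesis by (simp add: d_def)
qed

lemma poly_rate_tendsto_0:
  "(\<lambda>m. (real m + 1) ^ 2 * (2 * real m) * (2 * (real m + 1)) * rate ^ m) \<longlonglongrightarrow> 0"
proof -
  have "(\<lambda>m. (real m + 1) ^ 2 * (2 * real m) * (2 * (real m + 1)) * c ^ m) \<longlonglongrightarrow> 0" if "0 < c" "c < 1" for c :: real
    using that by real_asymp
  then show ?thesis using rate_pos rate_less_1 by blast
qed

section \<open>Cuts in preferential attachment processes\<close>

definition profile :: "nat set \<Rightarrow> nat \<Rightarrow> nat \<Rightarrow> nat multigraph set" where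
  "profile C i j = {T. num_edges_in T C = i \<and> num_edges_in T (- C) = j}"

lemma profile_compl: "profile (- C) j i = profile C i j"
  by (auto simp: profile_def)

lemma num_edges_in_add_mini_vertex:
  "num_edges_in (add_mini_vertex v T s) C = num_edges_in T C + of_bool (v \<in> C \<and> s \<in> C)"
  by (simp add: num_edges_in_def add_mini_vertex_def)

text \<open>
  The common part of the two models. The attachment probabilities enter only through an upper
  bound, weak enough to hold for both: \<open>2 * t - 1\<close> is the smaller of the two denominators, and the
  term for the new mini-vertex \<open>Suc t\<close> accounts for the loops of the first model.
\<close>

locale attachment_process =
  fixes P :: "nat \<Rightarrow> nat multigraph pmf" and K :: "nat \<Rightarrow> nat multigraph \<Rightarrow> nat pmf" and e\<^sub>1 :: "nat multiset"
  assumes first: "P (Suc 0) = return_pmf (Multigraph {1} {#e\<^sub>1#})" and first_loop: "e\<^sub>1 = {#1#} \<or> e\<^sub>1 = {#1, 1#}"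
    and step: "t \<ge> 1 \<Longrightarrow> P (Suc t) = bind_pmf (P t) (\<lambda>T. map_pmf (add_mini_vertex (Suc t) T) (K t T))"
    and endpoint: "t \<ge> 1 \<Longrightarrow> T \<in> set_pmf (P t) \<Longrightarrow> set_pmf (K t T) \<subseteq> {1..Suc t}"
    and prob_endpoint_le: "t \<ge> 1 \<Longrightarrow> T \<in> set_pmf (P t) \<Longrightarrow>
      measure_pmf.prob (K t T) C \<le> (real (vol T (C \<inter> {1..t})) + of_bool (Suc t \<in> C)) / (2 * real t - 1)"
begin

lemma support:
  assumes "t \<ge> 1" "T \<in> set_pmf (P t)"
  shows "(\<forall>e\<in>#edges T. edge_like e \<and> set_mset e \<subseteq> {1..t}) \<and> num_edges T = t \<and> 2 * t - 1 \<le> vol T {1..t}"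
  using assms
proof (induction t arbitrary: T rule: nat_induct_at_least)
  case base
  then show ?case using first first_loop
    by (auto simp: edge_like_def num_edges_def vol_def deg_def)
next
  case (Suc t)
  then obtain U i where U: "U \<in> set_pmf (P t)" and i: "i \<in> set_pmf (K t U)" and T: "T = add_mini_vertex (Suc t) U i"
    by (auto simp: step)
  have i': "i \<in> {1..Suc t}" using endpoint[OF Suc.hyps U] i by auto
  note IH = Suc.IH[OF U]
  have "vol T {1..Suc t} = vol U {1..Suc t} + 2"
    using i' by (simp add: vol_def T deg_add_mini_vertex sum.distrib)
  moreover have "vol U {1..t} \<le> vol U {1..Suc t}" by (simp add: vol_def)
  moreover have "2 * t - 1 \<le> vol U {1..t}" using IH by blast
  ultimately have "2 * t + 1 \<le> vol T {1..Suc t}" by linarith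
  then have "2 * Suc t - 1 \<le> vol T {1..Suc t}" by simp
  moreover have "num_edges T = Suc t" using IH by (simp add: T add_mini_vertex_def num_edges_def)
  moreover have "\<forall>e\<in>#edges T. edge_like e \<and> set_mset e \<subseteq> {1..Suc t}"
    using IH i' by (fastforce simp: T add_mini_vertex_def edge_like_def)
  ultimately show ?case by blast
qed

text \<open>
  The colour of the new mini-vertex is fixed, here to lie in \<open>C\<close>. So a profile is reached either
  from the profile with one edge less inside \<open>C\<close>, by an endpoint in \<open>C\<close>, or from itself, by a cut
  edge. In the second case the probability of the endpoint is estimated by 1.
\<close>

lemma prob_profile_step:
  assumes t: "t \<ge> 1" and C: "Suc t \<in> C"
  shows "measure_pmf.prob (P (Suc t)) (profile C i j)
    \<le> measure_pmf.prob (P t) {T. T \<in> profile C (i - 1) j \<and> i > 0} * (real (i + t - j) / (2 * real t - 1))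
      + measure_pmf.prob (P t) (profile C i j)"
proof -
  define A where "A = {T. T \<in> profile C (i - 1) j \<and> i > 0}"
  define c where "c = real (i + t - j) / (2 * real t - 1)"
  have c: "c \<ge> 0" using t by (simp add: c_def)
  have bound: "measure_pmf.prob (map_pmf (add_mini_vertex (Suc t) T) (K t T)) (profile C i j)
      \<le> c * indicator A T + indicator (profile C i j) T"
    if T: "T \<in> set_pmf (P t)" for T
  proof -
    have eq: "add_mini_vertex (Suc t) T -` profile C i j
        = {s. num_edges_in T C + of_bool (s \<in> C) = i \<and> num_edges_in T (- C) = j}"
      using C by (auto simp: profile_def num_edges_in_add_mini_vertex)
    show ?thesis
    proof (cases "T \<in> A")
      case True
      then have A: "num_edges_in T C = i - 1" "num_edges_in T (- C) = j" "i > 0"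
        by (auto simp: A_def profile_def)
      have "vol T (C \<inter> {1..t}) + num_edges_in T (- C) \<le> num_edges_in T C + num_edges T"
        using support[OF t T] by (intro vol_plus_num_edges_in_compl_le) auto
      then have v: "vol T (C \<inter> {1..t}) + 1 \<le> i + t - j" using A support[OF t T] by simp
      have "measure_pmf.prob (K t T) C \<le> (real (vol T (C \<inter> {1..t})) + of_bool (Suc t \<in> C)) / (2 * real t - 1)"
        by (rule prob_endpoint_le[OF t T])
      also have "\<dots> \<le> c"
        unfolding c_def using v t C by (intro divide_right_mono) auto
      finally have "measure_pmf.prob (K t T) C \<le> c" .
      moreover have "add_mini_vertex (Suc t) T -` profile C i j = C"
        using A unfolding eq by auto
      ultimately show ?thesis using True by (simp add: indicator_def)
    next
      case False
      show ?thesis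
      proof (cases "T \<in> profile C i j")
        case True
        then show ?thesis using False by simp
      next
        case nprof: False
        have "add_mini_vertex (Suc t) T -` profile C i j = {}"
          using False nprof unfolding eq by (auto simp: A_def profile_def)
        then show ?thesis using False nprof by simp
      qed
    qed
  qed
  have int: "integrable (measure_pmf (P t)) (\<lambda>T. c * indicator A T + indicator (profile C i j) T)"
    by (intro Bochner_Integration.integrable_add integrable_mult_right) (simp_all add: measure_pmf.emeasure_eq_measure)
  have "measure_pmf.prob (P (Suc t)) (profile C i j)
      = measure_pmf.expectation (P t) (\<lambda>T. measure_pmf.prob (map_pmf (add_mini_vertex (Suc t) T) (K t T)) (profile C i j))"
    unfolding step[OF t] measure_pmf_bind
    by (subst measure_pmf.measure_bind[where N="count_space UNIV"]) (auto simp: measure_subprob)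
  also have "\<dots> \<le> measure_pmf.expectation (P t) (\<lambda>T. c * indicator A T + indicator (profile C i j) T)"
  proof (rule integral_mono_AE[OF _ int])
    show "integrable (measure_pmf (P t))
        (\<lambda>T. measure_pmf.prob (map_pmf (add_mini_vertex (Suc t) T) (K t T)) (profile C i j))"
      by (rule measure_pmf.integrable_const_bound[where B = 1]) (auto simp: measure_pmf.prob_le_1)
    show "AE T in measure_pmf (P t). measure_pmf.prob (map_pmf (add_mini_vertex (Suc t) T) (K t T)) (profile C i j)
        \<le> c * indicator A T + indicator (profile C i j) T"
      unfolding AE_measure_pmf_iff using bound by blast
  qed
  also have "\<dots> = c * measure_pmf.prob (P t) A + measure_pmf.prob (P t) (profile C i j)"
    by (subst Bochner_Integration.integral_add) (simp_all add: measure_pmf.emeasure_eq_measure)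
  finally show ?thesis by (simp add: A_def c_def mult.commute)
qed

text \<open>
  The factor \<open>t choose b\<close> accounts for the times at which cut edges occur, and Pascal's rule is the
  induction step: if the last edge is cut, the bound comes from \<open>b - 1\<close> cut edges, and \<open>cut_weight\<close>
  does not decrease with the number of cut edges; if not, the urn step \<open>matched_step_le\<close> applies. The
  colouring \<open>C\<close> is arbitrary, however unevenly it distributes the colours over time. The factor
  \<open>2 * t - 1\<close> is the telescoping product of the quotients \<open>(2 * s + 1) / (2 * s - 1)\<close>, by which the
  denominators of the process fall short of those of the urn.
\<close>

lemma prob_profile_le:
  assumes "t \<ge> 1" "i + j + b = t"
  shows "measure_pmf.prob (P t) (profile C i j) \<le> (2 * real t - 1) * real (t choose b) * cut_weight i j (b div 2)"
  using assms
proof (induction t arbitrary: C i j b rule: nat_induct_at_least)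
  case base
  then consider "i = 1" "j = 0" "b = 0" | "i = 0" "j = 1" "b = 0" | "i = 0" "j = 0" "b = 1" by linarith
  then show ?case
    by cases (simp_all add: cut_weight_commute[of "Suc 0"] measure_pmf.prob_le_1)
next
  case (Suc t)
  note t = Suc.hyps
  \<comment> \<open>The bound is symmetric under exchanging the colours, so the new mini-vertex may be assumed to lie in the class.\<close>
  have main: "measure_pmf.prob (P (Suc t)) (profile D k l)
      \<le> (2 * real (Suc t) - 1) * real (Suc t choose b) * cut_weight k l (b div 2)"
    if D: "Suc t \<in> D" and sum: "k + l + b = Suc t" for D k l
  proof -
    define w where "w = cut_weight k l (b div 2)"
    have w: "w > 0" by (simp add: w_def cut_weight_pos)
    have grow: "measure_pmf.prob (P t) {T. T \<in> profile D (k - 1) l \<and> k > 0} * (real (k + t - l) / (2 * real t - 1))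
      \<le> (2 * real t + 1) * real (t choose b) * w"
    proof (cases k)
      case 0
      then show ?thesis using w by simp
    next
      case (Suc k')
      have s: "t = k' + l + b" using sum Suc by simp
      then have e: "k + t - l = 2 * k' + b + 1" using Suc by simp
      have "measure_pmf.prob (P t) (profile D k' l) * (real (2 * k' + b + 1) / (2 * real t - 1))
        \<le> ((2 * real t - 1) * real (t choose b) * cut_weight k' l (b div 2)) * (real (2 * k' + b + 1) / (2 * real t - 1))"
        using t s by (intro mult_right_mono Suc.IH) auto
      also have "\<dots> = real (t choose b) * (cut_weight k' l (b div 2) * real (2 * k' + b + 1))"
        using t by simp
      also have "\<dots> \<le> real (t choose b) * (cut_weight (Suc k') l (b div 2) * real (2 * t + 1))"
        by (intro mult_left_mono matched_step_le s) linarith+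
      finally show ?thesis unfolding e w_def using Suc by (simp add: mult_ac add_ac)
    qed
    have stay: "measure_pmf.prob (P t) (profile D k l) \<le> (2 * real t + 1) * real ((Suc t choose b) - (t choose b)) * w"
    proof (cases b)
      case 0
      have "T \<notin> profile D k l" if "T \<in> set_pmf (P t)" for T
        using num_edges_in_plus_compl_le[of T D] support[OF t that] sum 0 by (auto simp: profile_def)
      then have "measure_pmf.prob (P t) (profile D k l) = 0"
        by (auto simp: measure_pmf_zero_iff)
      then show ?thesis using w by simp
    next
      case (Suc b')
      have "measure_pmf.prob (P t) (profile D k l) \<le> (2 * real t - 1) * real (t choose b') * cut_weight k l (b' div 2)"
        using sum Suc by (intro Suc.IH) auto
      also have "\<dots> \<le> (2 * real t + 1) * real (t choose b') * w"
        unfolding w_def using t Suc by (intro mult_mono cut_weight_mono div_le_mono) (auto simp: cut_weight_pos less_imp_le)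
      finally show ?thesis using Suc by simp
    qed
    have "t choose b \<le> Suc t choose b" by (cases b) auto
    then have "real ((Suc t choose b) - (t choose b)) = real (Suc t choose b) - real (t choose b)"
      by (simp add: of_nat_diff)
    then show ?thesis
      using prob_profile_step[OF t D, of k l] grow stay unfolding w_def[symmetric] by (simp add: algebra_simps)
  qed
  show ?case
  proof (cases "Suc t \<in> C")
    case True
    then show ?thesis using main Suc.prems by blast
  next
    case False
    then show ?thesis
      using main[of "- C" j i] Suc.prems by (simp add: profile_compl cut_weight_commute add_ac)
  qed
qed

text \<open>
  A partition of the merged graph into two parts is a colouring of the mini-vertices that is
  constant on blocks. There are only \<open>2 ^ n \<le> 2 powr (m / 2)\<close> of these since \<open>h \<ge> 2\<close>, and merging
  preserves the numbers of edges inside the two classes, so the union bound runs over colourings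
  and over profiles of sparse balanced cuts of the tree.
\<close>

lemma prob_modularity_large_le:
  assumes m: "m \<ge> 200" and h: "h \<ge> 2" "m = h * n"
  shows "measure_pmf.prob (map_pmf (merge_blocks h n) (P m)) {G. \<not> modularity G \<le> 0.92383}
    \<le> (real m + 1) ^ 2 * (2 * real m) * (2 * (real m + 1)) * rate ^ m"
proof -
  define bad where "bad = {(i, j). \<exists>b. i + j + b = m \<and> 26 * b \<le> m
    \<and> 5 * m \<le> 14 * (i + b div 2) \<and> 5 * m \<le> 14 * (j + b div 2)}"
  define p where "p = 2 * real m * (2 * (real m + 1) * (rate ^ m / 2 powr (real m / 2)))"
  have bad_sub: "bad \<subseteq> {..m} \<times> {..m}" by (auto simp: bad_def)
  then have fin: "finite bad" by (rule finite_subset) simp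
  have cover: "T \<in> (\<Union>U\<in>Pow {1..n}. \<Union>(i, j)\<in>bad. profile (block h -` U) i j)"
    if T: "T \<in> set_pmf (P m)" and large: "\<not> modularity (merge_blocks h n T) \<le> 0.92383" for T
  proof -
    let ?G = "merge_blocks h n T"
    have "m \<ge> 1" using m by simp
    note sup = support[OF this T]
    have blk: "block h x \<in> {1..n}" if "x \<in> {1..m}" for x
    proof -
      have "(x - 1) div h < n" using that h by (intro div_less_iff_less_mult[THEN iffD2]) (auto simp: mult.commute)
      then show ?thesis by (simp add: block_def)
    qed
    have ge: "\<forall>e\<in>#edges ?G. edge_like e \<and> set_mset e \<subseteq> verts ?G"
      using sup blk by (fastforce simp: merge_blocks_def edge_like_def)
    have ne: "num_edges ?G = m" using sup by (simp add: merge_blocks_def num_edges_def)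
    have in_merge: "num_edges_in ?G U = num_edges_in T (block h -` U)" for U
      by (simp add: num_edges_in_def merge_blocks_def filter_mset_image_mset image_subset_iff_subset_vimage)
    have vol: "2 * real (num_edges ?G) - 1 \<le> real (vol ?G (verts ?G))"
    proof -
      have "vol ?G (verts ?G) = (\<Sum>e\<in>#edges ?G. size e)"
        using ge by (intro vol_full) (auto simp: merge_blocks_def)
      also have "\<dots> = (\<Sum>e\<in>#edges T. size e)"
        by (simp add: merge_blocks_def image_mset.compositionality comp_def)
      also have "\<dots> = vol T {1..m}" using sup by (intro vol_full[symmetric]) auto
      finally have "2 * m - 1 \<le> vol ?G (verts ?G)" using sup by simp
      then show ?thesis unfolding ne by linarith
    qed
    obtain U where U: "U \<subseteq> {1..n}" and cut: "let i = real (num_edges_in ?G U); j = real (num_edges_in ?G (- U)) in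
           real m - i - j \<le> real m / 26 \<and> 181 / 500 * (2 * real m - 1) \<le> real m + i - j \<and> 181 / 500 * (2 * real m - 1) \<le> real m + j - i"
      using balanced_sparse_cut_if_modularity_large[OF ge _ _ vol large] ne m by (auto simp: merge_blocks_def)
    define i where "i = num_edges_in T (block h -` U)"
    define j where "j = num_edges_in T (- (block h -` U))"
    have "num_edges_in ?G (- U) = j" by (simp add: in_merge j_def vimage_Compl)
    then have cut': "real m - real i - real j \<le> real m / 26"
      "181 / 500 * (2 * real m - 1) \<le> real m + real i - real j" "181 / 500 * (2 * real m - 1) \<le> real m + real j - real i"
      using cut by (simp_all add: in_merge[of U] i_def[symmetric] Let_def)
    have "i + j \<le> m" using num_edges_in_plus_compl_le[of T "block h -` U"] sup by (auto simp: i_def j_def)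
    then obtain b where b: "i + j + b = m" by (metis le_add_diff_inverse)
    have rm: "real m = real i + real j + real b" using b by linarith
    have "26 * real b \<le> real m" using cut'(1) rm by linarith
    then have b26: "26 * b \<le> m" by linarith
    \<comment> \<open>A balance of \<open>0.362\<close> exceeds \<open>5/14\<close>, about \<open>0.3572\<close>; for \<open>m \<ge> 200\<close> the difference absorbs the
        special loop and the rounding in \<open>b div 2\<close>.\<close>
    have "real b \<le> 2 * real (b div 2) + 1" by linarith
    moreover have "real m \<ge> 200" using m by simp
    ultimately have "5 * real m \<le> 14 * (real i + real (b div 2))" "5 * real m \<le> 14 * (real j + real (b div 2))"
      using cut'(2,3) rm by (simp_all add: algebra_simps)
    then have "real (5 * m) \<le> real (14 * (i + b div 2))" "real (5 * m) \<le> real (14 * (j + b div 2))"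
      by simp_all
    then have "5 * m \<le> 14 * (i + b div 2)" "5 * m \<le> 14 * (j + b div 2)"
      by (simp_all only: of_nat_le_iff)
    then have "(i, j) \<in> bad" using b b26 by (auto simp: bad_def)
    then show ?thesis using U by (auto simp: profile_def i_def j_def)
  qed
  have each: "measure_pmf.prob (P m) (profile C i j) \<le> p" if ij: "(i, j) \<in> bad" for C i j
  proof -
    obtain b where b: "i + j + b = m" "26 * b \<le> m" "5 * m \<le> 14 * (i + b div 2)" "5 * m \<le> 14 * (j + b div 2)"
      using ij by (auto simp: bad_def)
    have "measure_pmf.prob (P m) (profile C i j) \<le> (2 * real m - 1) * real (m choose b) * cut_weight i j (b div 2)"
      using m b by (intro prob_profile_le) auto
    also have "\<dots> = (2 * real m - 1) * (real (m choose b) * cut_weight i j (b div 2))" by simp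
    also have "\<dots> \<le> p"
      unfolding p_def using m by (intro mult_mono[OF _ cut_profile_count_le[OF b]]) (auto simp: cut_weight_pos less_imp_le)
    finally show ?thesis .
  qed
  have p: "p \<ge> 0" using rate_pos by (simp add: p_def)
  have "measure_pmf.prob (map_pmf (merge_blocks h n) (P m)) {G. \<not> modularity G \<le> 0.92383}
      = measure_pmf.prob (P m) {T. \<not> modularity (merge_blocks h n T) \<le> 0.92383}"
    by (simp add: vimage_def)
  also have "\<dots> \<le> measure_pmf.prob (P m) (\<Union>U\<in>Pow {1..n}. \<Union>(i, j)\<in>bad. profile (block h -` U) i j)"
    by (rule measure_pmf.finite_measure_mono_AE) (use cover in \<open>auto simp: AE_measure_pmf_iff\<close>)
  also have "\<dots> \<le> (\<Sum>U\<in>Pow {1..n}. measure_pmf.prob (P m) (\<Union>(i, j)\<in>bad. profile (block h -` U) i j))"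
    by (rule measure_pmf.finite_measure_subadditive_finite) auto
  also have "\<dots> \<le> (\<Sum>U\<in>Pow {1..n}. \<Sum>(i, j)\<in>bad. measure_pmf.prob (P m) (profile (block h -` U) i j))"
    unfolding split_def by (intro sum_mono measure_pmf.finite_measure_subadditive_finite fin) auto
  also have "\<dots> \<le> (\<Sum>U\<in>Pow {1..n}. \<Sum>(i, j)\<in>bad. p)"
    by (intro sum_mono) (auto simp: each)
  also have "\<dots> = 2 ^ n * (real (card bad) * p)" by (simp add: card_Pow split_def)
  also have "\<dots> \<le> 2 powr (real m / 2) * ((real m + 1) ^ 2 * p)"
  proof (intro mult_mono p)
    have "2 * n \<le> m" using h by simp
    then have "real n \<le> real m / 2" by linarith
    then have "2 powr real n \<le> (2::real) powr (real m / 2)" by (intro powr_mono) auto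
    then show "2 ^ n \<le> (2::real) powr (real m / 2)" by (simp add: powr_realpow)
    have "card bad \<le> (m + 1) * (m + 1)"
      using card_mono[OF _ bad_sub] by simp
    then have "real (card bad) \<le> real ((m + 1) * (m + 1))" by (simp only: of_nat_le_iff)
    then show "real (card bad) \<le> (real m + 1) ^ 2" by (simp add: power2_eq_square algebra_simps)
  qed (use p in auto)
  also have "\<dots> = (real m + 1) ^ 2 * (2 * real m) * (2 * (real m + 1)) * rate ^ m"
    by (simp add: p_def)
  finally show ?thesis .
qed

lemma prob_modularity_tendsto_1:
  assumes h: "h \<ge> 2"
  shows "(\<lambda>n. measure_pmf.prob (map_pmf (merge_blocks h n) (P (h * n))) {G. modularity G \<le> 0.92383}) \<longlonglongrightarrow> 1"
proof -
  let ?M = "\<lambda>n. map_pmf (merge_blocks h n) (P (h * n))"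
  have "filterlim (\<lambda>n. h * n) sequentially sequentially"
    using h by (intro mult_nat_left_at_top) auto
  from filterlim_compose[OF poly_rate_tendsto_0 this]
  have lim: "(\<lambda>n. (real (h * n) + 1) ^ 2 * (2 * real (h * n)) * (2 * (real (h * n) + 1)) * rate ^ (h * n)) \<longlonglongrightarrow> 0"
    by simp
  have "(\<lambda>n. measure_pmf.prob (?M n) {G. \<not> modularity G \<le> 0.92383}) \<longlonglongrightarrow> 0"
  proof (rule tendsto_sandwich[OF _ _ tendsto_const lim])
    show "\<forall>\<^sub>F n in sequentially. measure_pmf.prob (?M n) {G. \<not> modularity G \<le> 0.92383}
        \<le> (real (h * n) + 1) ^ 2 * (2 * real (h * n)) * (2 * (real (h * n) + 1)) * rate ^ (h * n)"
      using eventually_ge_at_top[of 200]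
    proof eventually_elim
      case (elim n)
      then have "h * n \<ge> 200" using h by (metis One_nat_def Suc_1 le_trans mult_le_mono1 nat_mult_1 one_le_numeral)
      then show ?case by (rule prob_modularity_large_le) (use h in auto)
    qed
  qed simp
  from tendsto_diff[OF tendsto_const[of 1] this] show ?thesis
    by (subst (asm) measure_pmf.prob_compl[symmetric]) (auto simp: Compl_eq_Diff_UNIV[symmetric] Collect_neg_eq)
qed

end

section \<open>The two models\<close>

lemma attachment_process_pa_tree: "attachment_process pa_tree attach {#1, 1#}"
proof
  fix t :: nat assume t: "t \<ge> 1"
  show "pa_tree (Suc t) = bind_pmf (pa_tree t) (\<lambda>T. map_pmf (add_mini_vertex (Suc t) T) (attach t T))"
    using t by (cases t) (simp_all add: map_pmf_def)
  fix T assume T: "T \<in> set_pmf (pa_tree t)"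
  show supp: "set_pmf (attach t T) \<subseteq> {1..Suc t}"
    by (auto simp: set_pmf_eq pmf_attach[OF T] split: if_splits)
  fix C
  have "measure_pmf.prob (attach t T) C = measure_pmf.prob (attach t T) (C \<inter> {1..Suc t})"
    by (rule measure_pmf.finite_measure_eq_AE) (use supp in \<open>auto simp: AE_measure_pmf_iff\<close>)
  also have "\<dots> = (\<Sum>s\<in>C \<inter> {1..Suc t}. pmf (attach t T) s)"
    by (rule measure_measure_pmf_finite) simp
  also have "\<dots> = (\<Sum>s\<in>{1..Suc t}. if s \<in> C then pmf (attach t T) s else 0)"
    by (subst Int_commute) (rule sum.inter_restrict, simp)
  also have "\<dots> = (\<Sum>s\<in>{1..t}. if s \<in> C then real (deg T s) / (2 * real t + 1) else 0) + of_bool (Suc t \<in> C) / (2 * real t + 1)"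
    by (simp add: pmf_attach[OF T] cong: sum.cong_simp if_cong)
  also have "\<dots> = (real (vol T (C \<inter> {1..t})) + of_bool (Suc t \<in> C)) / (2 * real t + 1)"
    by (simp add: sum.inter_restrict[symmetric] Int_commute vol_def add_divide_distrib sum_divide_distrib)
  also have "\<dots> \<le> (real (vol T (C \<inter> {1..t})) + of_bool (Suc t \<in> C)) / (2 * real t - 1)"
    using t by (intro divide_left_mono) auto
  finally show "measure_pmf.prob (attach t T) C \<le> (real (vol T (C \<inter> {1..t})) + of_bool (Suc t \<in> C)) / (2 * real t - 1)" .
qed auto

lemma attachment_process_pa_tree': "attachment_process pa_tree' attach' {#1#}"
proof
  fix t :: nat assume t: "t \<ge> 1"
  show "pa_tree' (Suc t) = bind_pmf (pa_tree' t) (\<lambda>T. map_pmf (add_mini_vertex (Suc t) T) (attach' t T))"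
    using t by (cases t) (simp_all add: map_pmf_def)
  fix T assume T: "T \<in> set_pmf (pa_tree' t)"
  have supp: "set_pmf (attach' t T) \<subseteq> {1..t}"
    by (auto simp: set_pmf_eq pmf_attach'[OF T t] split: if_splits)
  then show "set_pmf (attach' t T) \<subseteq> {1..Suc t}" by fastforce
  fix C
  have "measure_pmf.prob (attach' t T) C = measure_pmf.prob (attach' t T) (C \<inter> {1..t})"
    by (rule measure_pmf.finite_measure_eq_AE) (use supp in \<open>auto simp: AE_measure_pmf_iff\<close>)
  also have "\<dots> = (\<Sum>s\<in>C \<inter> {1..t}. pmf (attach' t T) s)"
    by (rule measure_measure_pmf_finite) simp
  also have "\<dots> = real (vol T (C \<inter> {1..t})) / (2 * real t - 1)"
    by (simp add: pmf_attach'[OF T t] vol_def sum_divide_distrib)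
  also have "\<dots> \<le> (real (vol T (C \<inter> {1..t})) + of_bool (Suc t \<in> C)) / (2 * real t - 1)"
    using t by (intro divide_right_mono) auto
  finally show "measure_pmf.prob (attach' t T) C \<le> (real (vol T (C \<inter> {1..t})) + of_bool (Suc t \<in> C)) / (2 * real t - 1)" .
qed auto

theorem corollary1p10:
  fixes h :: nat
  assumes "h \<ge> 2"
  shows "(\<lambda>n. measure_pmf.prob (pa_graph h n) {G. modularity G \<le> 0.92383}) \<longlonglongrightarrow> 1
       \<and> (\<lambda>n. measure_pmf.prob (pa_graph' h n) {G. modularity G \<le> 0.92383}) \<longlonglongrightarrow> 1"
  unfolding pa_graph_def pa_graph'_def
  using attachment_process.prob_modularity_tendsto_1[OF attachment_process_pa_tree assms]
    attachment_process.prob_modularity_tendsto_1[OF attachment_process_pa_tree' assms]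
  by simp

end
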